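(* Let $\Phi$ be an $N$-function in $\Delta_2(0)\cap\nabla_2(0)$ and let $G$ be a finitely generated (discrete) group with infinite center. Then $\overline{H}^1(G,\ell^\Phi(G))=0$.
   Context: An $N$-function is a function $\Phi:\mathbb{R}\to\mathbb{R}$ of the form $\Phi(x)=\int_0^{|x|}\varphi(t)\,dt$, where $\varphi:[0,\infty)\to[0,\infty)$ is non-decreasing, right-continuous, $\varphi(0)=0$, $\varphi(t)>0$ for $t>0$, and $\lim_{t\to\infty}\varphi(t)=\infty$. $\Phi\in\Delta_2(0)$ means: there are $x_0>0$ and $K>2$ with $\Phi(2x)\le K\Phi(x)$ for $0\le x\le x_0$. $\Phi\in\nabla_2(0)$ means: there are $x_0>0$ and $c>1$ with $\Phi(x)\le\frac{1}{2c}\Phi(cx)$ for $0\le x\le x_0$. For a countable set $X$ and $f:X\to\mathbb{R}$ put $\rho_\Phi(f)=\sum_{x\in X}\Phi(f(x))$. The Orlicz space is $\ell^\Phi(X)=\{f:X\to\mathbb{R} : \rho_\Phi(af)<\infty \text{ for some } a>0\}$, equipped with the gauge norm $\|f\|_{(\Phi)}=\inf\{k>0 : \rho_\Phi(f/k)\le 1\}$. For a discrete group $G$, $\ell^\Phi(G)$ is a Banach $G$-module under the left regular representation $(\lambda_G(g)f)(x)=f(g^{-1}x)$. For a discrete group $G$ and a Banach $G$-module $V$ (a Banach space with a linear isometric representation $\pi$ of $G$): $Z^1(G,V)=\{b:G\to V : b(gh)=b(g)+\pi(g)b(h)\ \forall g,h\in G\}$; $B^1(G,V)$ is the subspace of those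 $b$ for which there is $v\in V$ with $b(g)=\pi(g)v-v$ for all $g\in G$. Equip $Z^1(G,V)$ with the topology of uniform convergence on compact (i.e. finite) subsets of $G$, and let $\overline{B}^1(G,V)$ be the closure of $B^1(G,V)$; the reduced 1-cohomology is $\overline{H}^1(G,V)=Z^1(G,V)/\overline{B}^1(G,V)$. *)

theory Defs
  imports
    "HOL-Analysis.Analysis"
    "HOL-Library.Function_Algebras"
    "HOL-Algebra.Elementary_Groups"
begin

section \<open>N-functions\<close>

text \<open>Only the values of the density on \<open>[0, \<infinity>)\<close> matter.\<close>

definition N_density :: "(real \<Rightarrow> real) \<Rightarrow> bool" where
  "N_density \<phi> \<longleftrightarrow>
     mono_on {0..} \<phi> \<and>
     (\<forall>t\<ge>0. continuous (at_right t) \<phi>) \<and>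
     \<phi> 0 = 0 \<and> (\<forall>t>0. \<phi> t > 0) \<and>
     filterlim \<phi> at_top at_top"

definition N_function :: "(real \<Rightarrow> real) \<Rightarrow> bool" where
  "N_function \<Phi> \<longleftrightarrow>
     (\<exists>\<phi>. N_density \<phi> \<and> (\<forall>x. \<Phi> x = integral {0..\<bar>x\<bar>} \<phi>))"

definition Delta2_at_0 :: "(real \<Rightarrow> real) \<Rightarrow> bool" where
  "Delta2_at_0 \<Phi> \<longleftrightarrow>
     (\<exists>x0>0. \<exists>K>2. \<forall>x. 0 \<le> x \<and> x \<le> x0 \<longrightarrow> \<Phi> (2 * x) \<le> K * \<Phi> x)"

definition Nabla2_at_0 :: "(real \<Rightarrow> real) \<Rightarrow> bool" where
  "Nabla2_at_0 \<Phi> \<longleftrightarrow>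
     (\<exists>x0>0. \<exists>c>1. \<forall>x. 0 \<le> x \<and> x \<le> x0 \<longrightarrow> \<Phi> x \<le> 1 / (2 * c) * \<Phi> (c * x))"


section \<open>Orlicz sequence spaces\<close>

text \<open>
  The modular takes values in \<open>[0, \<infinity>]\<close>, so that it is defined for every function.
  A function on a set \<open>X\<close> is represented by its extension by zero to the whole type;
  in this way the vector space operations are the pointwise ones.
\<close>

definition modular :: "(real \<Rightarrow> real) \<Rightarrow> 'x set \<Rightarrow> ('x \<Rightarrow> real) \<Rightarrow> ennreal" where
  "modular \<Phi> X f = (\<Sum>\<^sub>\<infinity>x\<in>X. ennreal (\<Phi> (f x)))"

definition orlicz_space :: "(real \<Rightarrow> real) \<Rightarrow> 'x set \<Rightarrow> ('x \<Rightarrow> real) set" where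
  "orlicz_space \<Phi> X =
     {f. (\<forall>x. x \<notin> X \<longrightarrow> f x = 0) \<and> (\<exists>a>0. modular \<Phi> X (\<lambda>x. a * f x) < \<infinity>)}"

definition gauge_norm :: "(real \<Rightarrow> real) \<Rightarrow> 'x set \<Rightarrow> ('x \<Rightarrow> real) \<Rightarrow> real" where
  "gauge_norm \<Phi> X f = Inf {k. k > 0 \<and> modular \<Phi> X (\<lambda>x. f x / k) \<le> 1}"

definition left_regular ::
    "('g, 'm) monoid_scheme \<Rightarrow> 'g \<Rightarrow> ('g \<Rightarrow> real) \<Rightarrow> ('g \<Rightarrow> real)" where
  "left_regular G g f =
     (\<lambda>x. if x \<in> carrier G then f (inv\<^bsub>G\<^esub> g \<otimes>\<^bsub>G\<^esub> x) else 0)"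


section \<open>Groups\<close>

definition center :: "('g, 'm) monoid_scheme \<Rightarrow> 'g set" where
  "center G = {z \<in> carrier G. \<forall>g\<in>carrier G. z \<otimes>\<^bsub>G\<^esub> g = g \<otimes>\<^bsub>G\<^esub> z}"

definition finitely_generated :: "('g, 'm) monoid_scheme \<Rightarrow> bool" where
  "finitely_generated G \<longleftrightarrow>
     (\<exists>S. finite S \<and> S \<subseteq> carrier G \<and> generate G S = carrier G)"


section \<open>Reduced first cohomology of a discrete group\<close>

text \<open>
  The coefficient module is given by its underlying set \<open>V\<close> of vectors (in an ambient
  abelian group), its norm \<open>N\<close> and the action \<open>\<pi>\<close>. Cochains are extended by zero
  outside the carrier of \<open>G\<close>.
\<close>

definition cocycles ::
    "('g, 'm) monoid_scheme \<Rightarrow> 'v::ab_group_add set \<Rightarrow> ('g \<Rightarrow> 'v \<Rightarrow> 'v) \<Rightarrow> ('g \<Rightarrow> 'v) set" where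
  "cocycles G V \<pi> =
     {b. (\<forall>g\<in>carrier G. b g \<in> V) \<and> (\<forall>g. g \<notin> carrier G \<longrightarrow> b g = 0) \<and>
         (\<forall>g\<in>carrier G. \<forall>h\<in>carrier G. b (g \<otimes>\<^bsub>G\<^esub> h) = b g + \<pi> g (b h))}"

definition coboundaries ::
    "('g, 'm) monoid_scheme \<Rightarrow> 'v::ab_group_add set \<Rightarrow> ('g \<Rightarrow> 'v \<Rightarrow> 'v) \<Rightarrow> ('g \<Rightarrow> 'v) set" where
  "coboundaries G V \<pi> =
     {b \<in> cocycles G V \<pi>. \<exists>v\<in>V. \<forall>g\<in>carrier G. b g = \<pi> g v - v}"

text \<open>
  Uniform convergence on compact sets; as the group is discrete, these are the finite sets.
\<close>

definition cocycle_open ::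
    "('g, 'm) monoid_scheme \<Rightarrow> 'v::ab_group_add set \<Rightarrow> ('v \<Rightarrow> real) \<Rightarrow> ('g \<Rightarrow> 'v \<Rightarrow> 'v) \<Rightarrow>
     ('g \<Rightarrow> 'v) set \<Rightarrow> bool" where
  "cocycle_open G V N \<pi> U \<longleftrightarrow>
     U \<subseteq> cocycles G V \<pi> \<and>
     (\<forall>b\<in>U. \<exists>F \<epsilon>. finite F \<and> F \<subseteq> carrier G \<and> \<epsilon> > 0 \<and>
        {c \<in> cocycles G V \<pi>. \<forall>g\<in>F. N (c g - b g) < \<epsilon>} \<subseteq> U)"

definition cocycle_topology ::
    "('g, 'm) monoid_scheme \<Rightarrow> 'v::ab_group_add set \<Rightarrow> ('v \<Rightarrow> real) \<Rightarrow> ('g \<Rightarrow> 'v \<Rightarrow> 'v) \<Rightarrow>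
     ('g \<Rightarrow> 'v) topology" where
  "cocycle_topology G V N \<pi> = topology (cocycle_open G V N \<pi>)"

lemma istopology_cocycle_open: "istopology (cocycle_open G V N \<pi>)"
  unfolding istopology_def
proof (intro conjI allI impI)
  fix S T assume S: "cocycle_open G V N \<pi> S" and T: "cocycle_open G V N \<pi> T"
  show "cocycle_open G V N \<pi> (S \<inter> T)"
    unfolding cocycle_open_def
  proof (intro conjI ballI)
    show "S \<inter> T \<subseteq> cocycles G V \<pi>"
      using S by (auto simp: cocycle_open_def)
    fix b assume b: "b \<in> S \<inter> T"
    obtain F1 e1 where 1: "finite F1" "F1 \<subseteq> carrier G" "e1 > 0"
        "{c \<in> cocycles G V \<pi>. \<forall>g\<in>F1. N (c g - b g) < e1} \<subseteq> S"
      using S b unfolding cocycle_open_def by blast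
    obtain F2 e2 where 2: "finite F2" "F2 \<subseteq> carrier G" "e2 > 0"
        "{c \<in> cocycles G V \<pi>. \<forall>g\<in>F2. N (c g - b g) < e2} \<subseteq> T"
      using T b unfolding cocycle_open_def by blast
    show "\<exists>F \<epsilon>. finite F \<and> F \<subseteq> carrier G \<and> \<epsilon> > 0 \<and>
        {c \<in> cocycles G V \<pi>. \<forall>g\<in>F. N (c g - b g) < \<epsilon>} \<subseteq> S \<inter> T"
    proof (intro exI conjI)
      show "finite (F1 \<union> F2)" "F1 \<union> F2 \<subseteq> carrier G" "min e1 e2 > 0"
        using 1 2 by simp_all
      show "{c \<in> cocycles G V \<pi>. \<forall>g\<in>F1 \<union> F2. N (c g - b g) < min e1 e2} \<subseteq> S \<inter> T"
        using 1(4) 2(4) by (simp add: subset_iff)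
    qed
  qed
next
  fix \<K> assume K: "\<forall>K\<in>\<K>. cocycle_open G V N \<pi> K"
  show "cocycle_open G V N \<pi> (\<Union>\<K>)"
    unfolding cocycle_open_def
  proof (intro conjI ballI)
    show "\<Union>\<K> \<subseteq> cocycles G V \<pi>"
      using K by (auto simp: cocycle_open_def)
    fix b assume "b \<in> \<Union>\<K>"
    then obtain K0 where K0: "K0 \<in> \<K>" "b \<in> K0" by blast
    moreover have "cocycle_open G V N \<pi> K0"
      using K K0 by simp
    ultimately obtain F e where F: "finite F" "F \<subseteq> carrier G" "e > 0"
        "{c \<in> cocycles G V \<pi>. \<forall>g\<in>F. N (c g - b g) < e} \<subseteq> K0"
      unfolding cocycle_open_def by blast
    have "K0 \<subseteq> \<Union>\<K>"
      using K0(1) by (rule Union_upper)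
    with F show "\<exists>F \<epsilon>. finite F \<and> F \<subseteq> carrier G \<and> \<epsilon> > 0 \<and>
        {c \<in> cocycles G V \<pi>. \<forall>g\<in>F. N (c g - b g) < \<epsilon>} \<subseteq> \<Union>\<K>"
      by (meson order_trans)
  qed
qed

lemma openin_cocycle_topology:
  "openin (cocycle_topology G V N \<pi>) = cocycle_open G V N \<pi>"
  by (simp add: cocycle_topology_def istopology_cocycle_open topology_inverse')

lemma topspace_cocycle_topology: "topspace (cocycle_topology G V N \<pi>) = cocycles G V \<pi>"
proof -
  have "cocycle_open G V N \<pi> (cocycles G V \<pi>)"
    unfolding cocycle_open_def by (auto intro!: exI[of _ "{}"] exI[of _ "1::real"])
  moreover have "U \<subseteq> cocycles G V \<pi>" if "cocycle_open G V N \<pi> U" for U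
    using that by (simp add: cocycle_open_def)
  ultimately show ?thesis
    unfolding topspace_def openin_cocycle_topology by blast
qed

definition reduced_coboundaries ::
    "('g, 'm) monoid_scheme \<Rightarrow> 'v::ab_group_add set \<Rightarrow> ('v \<Rightarrow> real) \<Rightarrow> ('g \<Rightarrow> 'v \<Rightarrow> 'v) \<Rightarrow>
     ('g \<Rightarrow> 'v) set" where
  "reduced_coboundaries G V N \<pi> = cocycle_topology G V N \<pi> closure_of coboundaries G V \<pi>"

text \<open>
  \<open>Z\<^sup>1\<close> with pointwise addition, and its quotient, as (multiplicatively written) groups:
  for the vanishing of the quotient the scalar multiplication plays no role.
\<close>

definition cocycle_group ::
    "('g, 'm) monoid_scheme \<Rightarrow> 'v::ab_group_add set \<Rightarrow> ('g \<Rightarrow> 'v \<Rightarrow> 'v) \<Rightarrow> ('g \<Rightarrow> 'v) monoid" where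
  "cocycle_group G V \<pi> =
     \<lparr>carrier = cocycles G V \<pi>, monoid.mult = (\<lambda>b c. b + c), one = 0\<rparr>"

definition reduced_H1 ::
    "('g, 'm) monoid_scheme \<Rightarrow> 'v::ab_group_add set \<Rightarrow> ('v \<Rightarrow> real) \<Rightarrow> ('g \<Rightarrow> 'v \<Rightarrow> 'v) \<Rightarrow>
     ('g \<Rightarrow> 'v) set monoid" where
  "reduced_H1 G V N \<pi> = cocycle_group G V \<pi> Mod reduced_coboundaries G V N \<pi>"

end

theory Submission
  imports Defs "HOL-Real_Asymp.Real_Asymp"
begin

text \<open>
  Let \<open>b\<close> be a cocycle with values in \<open>\<ell>\<^sup>\<Phi>(G)\<close> and \<open>z\<close> a central element. Expanding both
  sides of \<open>b(zg) = b(gz)\<close> gives \<open>g\<cdot>b(z) - b(z) = z\<cdot>b(g) - b(g)\<close> (\<open>cocycle_central\<close>).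
  Choose infinitely many distinct central elements \<open>z\<^sub>0, z\<^sub>1, \<dots>\<close> and put
  \<open>v\<^sub>n = -(b(z\<^sub>0) + \<dots> + b(z\<^bsub>n-1\<^esub>)) / n\<close>. Averaging the identity over these elements yields
  \<open>g\<cdot>v\<^sub>n - v\<^sub>n = b(g) - (z\<^sub>0\<cdot>b(g) + \<dots> + z\<^bsub>n-1\<^esub>\<cdot>b(g)) / n\<close>,
  so that the coboundaries of the \<open>v\<^sub>n\<close> converge to \<open>b\<close> as soon as averages over distinct
  translates of a vector tend to \<open>0\<close> in norm.

  That is \<open>translate_average_eventually_small\<close>, a concrete mean ergodic theorem. By the
  doubling condition, \<open>f\<close> in \<open>\<ell>\<^sup>\<Phi>(G)\<close> is a finitely supported function plus a remainder of
  small modular. The modular is convex and translation invariant, so averaging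
  the remainder leaves its modular small. The average of the finitely supported part is
  \<open>O(1/n)\<close> in size and lives on \<open>O(n)\<close> points; its modular is \<open>O(n \<Phi>(C/n))\<close>, which
  tends to \<open>0\<close> because \<open>\<Phi>(t)/t\<close> tends to \<open>0\<close> with \<open>t\<close> (\<open>N_function_sublinear_at_0\<close>).
\<close>

section \<open>N-functions\<close>

text \<open>
  A monotone density supports its integral from below at every point. Positivity,
  monotonicity, convexity and the behaviour at \<open>0\<close> of an N-function follow from this
  inequality and the values of the density.
\<close>

lemma N_density_subgradient:
  assumes \<phi>: "N_density \<phi>" and "0 \<le> x" "0 \<le> y"
  shows "\<phi> x * (y - x) \<le> integral {0..y} \<phi> - integral {0..x} \<phi>"
proof -
  have mono: "\<phi> s \<le> \<phi> t" if "0 \<le> s" "s \<le> t" for s t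
    using \<phi> that unfolding N_density_def mono_on_def by auto
  have int: "\<phi> integrable_on {a..b}" if "0 \<le> a" for a b
    using that by (intro integrable_on_mono_on mono_onI mono) auto
  show ?thesis
  proof (cases "x \<le> y")
    case True
    have "integral {x..y} (\<lambda>_. \<phi> x) \<le> integral {x..y} \<phi>"
      using assms by (intro integral_le int mono) auto
    moreover have "integral {0..x} \<phi> + integral {x..y} \<phi> = integral {0..y} \<phi>"
      using assms True by (intro Henstock_Kurzweil_Integration.integral_combine int) auto
    ultimately show ?thesis using True by (simp add: mult.commute)
  next
    case False
    have "integral {y..x} \<phi> \<le> integral {y..x} (\<lambda>_. \<phi> x)"
      using assms by (intro integral_le int mono) auto
    moreover have "integral {0..y} \<phi> + integral {y..x} \<phi> = integral {0..x} \<phi>"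
      using assms False by (intro Henstock_Kurzweil_Integration.integral_combine int) auto
    ultimately show ?thesis using False by (simp add: algebra_simps)
  qed
qed

lemma N_function_zero: "N_function \<Phi> \<Longrightarrow> \<Phi> 0 = 0"
  unfolding N_function_def by auto

lemma N_function_abs: "N_function \<Phi> \<Longrightarrow> \<Phi> \<bar>x\<bar> = \<Phi> x"
  unfolding N_function_def by auto

lemma N_function_subgradient:
  assumes "N_function \<Phi>"
  obtains \<phi> where "N_density \<phi>"
    "\<And>x y. 0 \<le> x \<Longrightarrow> 0 \<le> y \<Longrightarrow> \<phi> x * (y - x) \<le> \<Phi> y - \<Phi> x"
  using assms N_density_subgradient unfolding N_function_def by (metis abs_of_nonneg)

lemma N_density_nonneg: "N_density \<phi> \<Longrightarrow> 0 \<le> t \<Longrightarrow> 0 \<le> \<phi> t"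
  unfolding N_density_def by (metis less_eq_real_def)

lemma N_function_mono:
  assumes "N_function \<Phi>" "\<bar>x\<bar> \<le> \<bar>y\<bar>"
  shows "\<Phi> x \<le> \<Phi> y"
proof -
  obtain \<phi> where \<phi>: "N_density \<phi>"
    and sub: "\<And>x y. 0 \<le> x \<Longrightarrow> 0 \<le> y \<Longrightarrow> \<phi> x * (y - x) \<le> \<Phi> y - \<Phi> x"
    using N_function_subgradient[OF assms(1)] by blast
  have "0 \<le> \<phi> \<bar>x\<bar> * (\<bar>y\<bar> - \<bar>x\<bar>)"
    using N_density_nonneg[OF \<phi>] assms(2) by simp
  then show ?thesis
    using sub[of "\<bar>x\<bar>" "\<bar>y\<bar>"] N_function_abs[OF assms(1)] by simp
qed

lemma N_function_nonneg: "N_function \<Phi> \<Longrightarrow> 0 \<le> \<Phi> x"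
  using N_function_mono[of \<Phi> 0 x] by (simp add: N_function_zero)

lemma N_function_pos:
  assumes "N_function \<Phi>" "0 < x"
  shows "0 < \<Phi> x"
proof -
  obtain \<phi> where \<phi>: "N_density \<phi>"
    and sub: "\<And>x y. 0 \<le> x \<Longrightarrow> 0 \<le> y \<Longrightarrow> \<phi> x * (y - x) \<le> \<Phi> y - \<Phi> x"
    using N_function_subgradient[OF assms(1)] by blast
  have "0 < \<phi> (x / 2) * (x - x / 2)"
    using \<phi> assms(2) unfolding N_density_def by simp
  also have "\<dots> \<le> \<Phi> x - \<Phi> (x / 2)"
    using assms(2) by (intro sub) auto
  finally show ?thesis
    using N_function_nonneg[OF assms(1), of "x / 2"] by simp
qed

lemma N_function_convex:
  assumes "N_function \<Phi>"
  shows "convex_on UNIV \<Phi>"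
proof -
  obtain \<phi> where \<phi>: "N_density \<phi>"
    and sub: "\<And>x y. 0 \<le> x \<Longrightarrow> 0 \<le> y \<Longrightarrow> \<phi> x * (y - x) \<le> \<Phi> y - \<Phi> x"
    using N_function_subgradient[OF assms] by blast
  have "\<Phi> (u * x + v * y) \<le> u * \<Phi> x + v * \<Phi> y" if uv: "0 \<le> u" "0 \<le> v" "u + v = 1" for x y u v
  proof -
    define m where "m = u * \<bar>x\<bar> + v * \<bar>y\<bar>"
    have m: "0 \<le> m" using uv by (simp add: m_def)
    have "\<bar>u * x + v * y\<bar> \<le> m"
      using uv abs_triangle_ineq[of "u * x" "v * y"] by (simp add: m_def abs_mult)
    then have "\<Phi> (u * x + v * y) \<le> \<Phi> m"
      using m by (intro N_function_mono[OF assms]) simp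
    moreover have "u * (\<phi> m * (\<bar>x\<bar> - m)) + v * (\<phi> m * (\<bar>y\<bar> - m))
        \<le> u * (\<Phi> \<bar>x\<bar> - \<Phi> m) + v * (\<Phi> \<bar>y\<bar> - \<Phi> m)"
      using uv m by (intro add_mono mult_left_mono sub) auto
    moreover have "u * (\<phi> m * (\<bar>x\<bar> - m)) + v * (\<phi> m * (\<bar>y\<bar> - m)) = \<phi> m * (m - (u + v) * m)"
      unfolding m_def by (simp add: algebra_simps)
    moreover have "u * (\<Phi> \<bar>x\<bar> - \<Phi> m) + v * (\<Phi> \<bar>y\<bar> - \<Phi> m)
        = u * \<Phi> \<bar>x\<bar> + v * \<Phi> \<bar>y\<bar> - (u + v) * \<Phi> m"
      by (simp add: algebra_simps)
    ultimately show ?thesis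
      using uv N_function_abs[OF assms] by simp
  qed
  then show ?thesis
    by (simp add: convex_on_def)
qed

lemma N_function_half_add:
  assumes "N_function \<Phi>"
  shows "\<Phi> (x + y) \<le> (1/2) * \<Phi> (2 * x) + (1/2) * \<Phi> (2 * y)"
proof -
  have "\<Phi> ((1/2) *\<^sub>R (2 * x) + (1/2) *\<^sub>R (2 * y)) \<le> (1/2) * \<Phi> (2 * x) + (1/2) * \<Phi> (2 * y)"
    using N_function_convex[OF assms] unfolding convex_on_def
    by (metis UNIV_I field_sum_of_halves zero_le_divide_1_iff zero_le_numeral)
  then show ?thesis by simp
qed

lemma N_function_average:
  assumes "N_function \<Phi>" "0 < n"
  shows "\<Phi> ((\<Sum>i<n. t i) / real n) \<le> (\<Sum>i<n. \<Phi> (t i)) / real n"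
proof -
  have "\<Phi> (\<Sum>i<n. (1 / real n) *\<^sub>R t i) \<le> (\<Sum>i<n. (1 / real n) * \<Phi> (t i))"
    using assms N_function_convex[of \<Phi>] by (intro convex_on_sum[where C = UNIV]) auto
  then show ?thesis by (simp add: sum_divide_distrib)
qed

text \<open>
  The subgradient inequality at \<open>t\<close>, read at \<open>0\<close>, is \<open>\<Phi>(t) \<le> t \<phi>(t)\<close>, and \<open>\<phi>(t)\<close> tends
  to \<open>\<phi>(0) = 0\<close> by right-continuity. This is what separates N-functions from
  \<open>\<bar>t\<bar>\<close>: in \<open>\<ell>\<^sup>1\<close>, averages of translates of a nonnegative vector keep their norm.
\<close>

lemma N_function_sublinear_at_0:
  assumes "N_function \<Phi>"
  shows "(\<lambda>n. real n * \<Phi> (C / real n)) \<longlonglongrightarrow> 0"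
proof -
  obtain \<phi> where \<phi>: "N_density \<phi>"
    and sub: "\<And>x y. 0 \<le> x \<Longrightarrow> 0 \<le> y \<Longrightarrow> \<phi> x * (y - x) \<le> \<Phi> y - \<Phi> x"
    using N_function_subgradient[OF assms] by blast
  \<comment> \<open>\<open>C\<close> may be zero or negative; a positive bound makes \<open>D/n\<close> approach \<open>0\<close> from the right.\<close>
  define D where "D = \<bar>C\<bar> + 1"
  have D: "D > 0" "\<bar>C\<bar> \<le> D" by (auto simp: D_def)
  have "(\<phi> \<longlongrightarrow> \<phi> 0) (at_right 0)"
    using \<phi> unfolding N_density_def continuous_within by blast
  moreover have "filterlim (\<lambda>n. D / real n) (at_right 0) sequentially"
    using D(1) by real_asymp
  ultimately have "(\<lambda>n. \<phi> (D / real n)) \<longlonglongrightarrow> \<phi> 0"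
    by (rule filterlim_compose)
  then have lim: "(\<lambda>n. D * \<phi> (D / real n)) \<longlonglongrightarrow> 0"
    using \<phi> unfolding N_density_def by (auto intro: tendsto_mult_right_zero)
  show ?thesis
  proof (rule tendsto_sandwich[OF _ _ tendsto_const lim])
    show "\<forall>\<^sub>F n in sequentially. 0 \<le> real n * \<Phi> (C / real n)"
      by (simp add: N_function_nonneg[OF assms])
    show "\<forall>\<^sub>F n in sequentially. real n * \<Phi> (C / real n) \<le> D * \<phi> (D / real n)"
      using eventually_gt_at_top[of 0]
    proof eventually_elim
      case (elim n)
      have "\<Phi> (C / real n) \<le> \<Phi> (D / real n)"
        using D elim by (intro N_function_mono[OF assms]) (simp add: divide_right_mono)
      also have "\<dots> \<le> \<phi> (D / real n) * (D / real n)"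
        using sub[of "D / real n" 0] D by (simp add: N_function_zero[OF assms])
      finally have "real n * \<Phi> (C / real n) \<le> real n * (\<phi> (D / real n) * (D / real n))"
        by (rule mult_left_mono) simp
      also have "\<dots> = D * \<phi> (D / real n)" using elim by simp
      finally show ?case .
    qed
  qed
qed

section \<open>The modular and the Orlicz space under the doubling condition\<close>

lemma modular_eq_ennreal_infsum:
  assumes "N_function \<Phi>" "(\<lambda>x. \<Phi> (f x)) summable_on X"
  shows "modular \<Phi> X f = ennreal (\<Sum>\<^sub>\<infinity>x\<in>X. \<Phi> (f x))"
proof -
  have "sum (ennreal \<circ> (\<lambda>x. \<Phi> (f x))) F = ennreal (\<Sum>x\<in>F. \<Phi> (f x))" for F
    by (simp add: N_function_nonneg[OF assms(1)])
  then have "ennreal (\<Sum>\<^sub>\<infinity>x\<in>X. \<Phi> (f x)) = infsum (ennreal \<circ> (\<lambda>x. \<Phi> (f x))) X"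
    by (simp add: infsum_comm_additive_general assms)
  then show ?thesis by (simp add: modular_def o_def)
qed

lemma modular_finite_iff:
  assumes "N_function \<Phi>"
  shows "modular \<Phi> X f < \<infinity> \<longleftrightarrow> (\<lambda>x. \<Phi> (f x)) summable_on X"
proof
  assume fin: "modular \<Phi> X f < \<infinity>"
  show "(\<lambda>x. \<Phi> (f x)) summable_on X"
  proof (rule nonneg_bdd_above_summable_on)
    show "bdd_above (sum (\<lambda>x. \<Phi> (f x)) ` {F. F \<subseteq> X \<and> finite F})"
    proof (rule bdd_aboveI2)
      fix F assume "F \<in> {F. F \<subseteq> X \<and> finite F}"
      then have "(\<Sum>x\<in>F. ennreal (\<Phi> (f x))) \<le> modular \<Phi> X f"
        unfolding modular_def by (subst nonneg_infsum_complete) (auto intro: SUP_upper)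
      then have "ennreal (\<Sum>x\<in>F. \<Phi> (f x)) \<le> modular \<Phi> X f"
        by (simp add: N_function_nonneg[OF assms])
      then show "(\<Sum>x\<in>F. \<Phi> (f x)) \<le> enn2real (modular \<Phi> X f)"
        using fin by (metis enn2real_ennreal enn2real_mono infinity_ennreal_def
            N_function_nonneg[OF assms] sum_nonneg)
    qed
  qed (simp add: N_function_nonneg[OF assms])
qed (simp add: modular_eq_ennreal_infsum[OF assms])

text \<open>
  The doubling inequality is available only where \<open>\<bar>f\<bar> \<le> x0\<close>. That suffices, because each point
  with \<open>\<bar>f\<bar> > x0\<close> contributes at least \<open>\<Phi>(x0) > 0\<close> to a convergent sum, so there are only
  finitely many of them.
\<close>

lemma Delta2_summable_double:
  assumes \<Phi>: "N_function \<Phi>" and \<Delta>: "Delta2_at_0 \<Phi>"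
    and sum: "(\<lambda>x. \<Phi> (f x)) summable_on X"
  shows "(\<lambda>x. \<Phi> (2 * f x)) summable_on X"
proof -
  obtain x0 K where "x0 > 0" "K > 2"
    and K: "\<And>x. 0 \<le> x \<Longrightarrow> x \<le> x0 \<Longrightarrow> \<Phi> (2 * x) \<le> K * \<Phi> x"
    using \<Delta> unfolding Delta2_at_0_def by blast
  define E where "E = {x \<in> X. x0 < \<bar>f x\<bar>}"
  have "finite E"
  proof (rule ccontr)
    assume "infinite E"
    define S where "S = (\<Sum>\<^sub>\<infinity>x\<in>X. \<Phi> (f x))"
    have pos: "0 < \<Phi> x0" by (rule N_function_pos[OF \<Phi> \<open>x0 > 0\<close>])
    obtain m where m: "S < real m * \<Phi> x0"
      using pos by (rule reals_Archimedean3[THEN spec, THEN exE])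
    obtain F where F: "finite F" "card F = m" "F \<subseteq> E"
      using infinite_arbitrarily_large[OF \<open>infinite E\<close>] by blast
    have "real m * \<Phi> x0 = (\<Sum>x\<in>F. \<Phi> x0)" using F by simp
    also have "\<dots> \<le> (\<Sum>x\<in>F. \<Phi> (f x))"
      using F \<open>x0 > 0\<close> by (intro sum_mono N_function_mono[OF \<Phi>]) (auto simp: E_def)
    also have "\<dots> \<le> S"
      unfolding S_def using F
      by (intro finite_sum_le_infsum sum N_function_nonneg[OF \<Phi>]) (auto simp: E_def)
    finally show False using m by simp
  qed
  have "(\<lambda>x. \<Phi> (2 * f x)) summable_on E" using \<open>finite E\<close> by simp
  moreover have "(\<lambda>x. \<Phi> (2 * f x)) summable_on (X - E)"
  proof (rule summable_on_comparison_test)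
    show "(\<lambda>x. K * \<Phi> (f x)) summable_on (X - E)"
      using sum by (intro summable_on_cmult_right) (auto intro: summable_on_subset_banach)
    show "\<Phi> (2 * f x) \<le> K * \<Phi> (f x)" if "x \<in> X - E" for x
      using K[of "\<bar>f x\<bar>"] that N_function_abs[OF \<Phi>, of "2 * f x"] N_function_abs[OF \<Phi>, of "f x"]
      by (auto simp: E_def abs_mult not_less)
  qed (rule N_function_nonneg[OF \<Phi>])
  ultimately have "(\<lambda>x. \<Phi> (2 * f x)) summable_on (E \<union> (X - E))"
    by (intro summable_on_Un_disjoint) auto
  then show ?thesis by (simp add: E_def Un_absorb1 subset_iff)
qed

lemma N_function_summable_mono:
  assumes "N_function \<Phi>" "(\<lambda>x. \<Phi> (f x)) summable_on X" "\<And>x. x \<in> X \<Longrightarrow> \<bar>g x\<bar> \<le> \<bar>f x\<bar>"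
  shows "(\<lambda>x. \<Phi> (g x)) summable_on X"
  using assms N_function_mono[OF assms(1)] N_function_nonneg[OF assms(1)]
  by (intro summable_on_comparison_test[OF assms(2)]) auto

text \<open>
  Under the doubling condition one finite modular \<open>\<rho>(a f)\<close> makes all of them finite. Hence
  every \<open>f\<close> in the space has tails of arbitrarily small modular at every scale, which is how
  density of the finitely supported functions is used below.
\<close>

lemma orlicz_space_iff_summable:
  assumes \<Phi>: "N_function \<Phi>" and \<Delta>: "Delta2_at_0 \<Phi>"
  shows "f \<in> orlicz_space \<Phi> X \<longleftrightarrow>
    (\<forall>x. x \<notin> X \<longrightarrow> f x = 0) \<and> (\<forall>c. (\<lambda>x. \<Phi> (c * f x)) summable_on X)"
proof -
  have "(\<lambda>x. \<Phi> (c * f x)) summable_on X"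
    if a: "a > 0" "(\<lambda>x. \<Phi> (a * f x)) summable_on X" for a c
  proof -
    have pow: "(\<lambda>x. \<Phi> (2 ^ m * (a * f x))) summable_on X" for m
    proof (induction m)
      case (Suc m)
      then show ?case using Delta2_summable_double[OF \<Phi> \<Delta> Suc] by (simp add: mult.assoc)
    qed (use a in simp)
    obtain m where "\<bar>c\<bar> / a < 2 ^ m"
      using real_arch_pow[of 2 "\<bar>c\<bar> / a"] by auto
    then have m: "\<bar>c\<bar> \<le> 2 ^ m * a"
      using a(1) by (simp add: field_simps)
    show ?thesis
    proof (rule N_function_summable_mono[OF \<Phi> pow[of m]])
      show "\<bar>c * f x\<bar> \<le> \<bar>2 ^ m * (a * f x)\<bar>" for x
        using mult_right_mono[OF m, of "\<bar>f x\<bar>"] a(1) by (simp add: abs_mult mult.assoc)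
    qed
  qed
  then show ?thesis
    unfolding orlicz_space_def modular_finite_iff[OF \<Phi>] by (auto intro: zero_less_one)
qed

context
  fixes \<Phi> :: "real \<Rightarrow> real" and X :: "'x set"
  assumes \<Phi>: "N_function \<Phi>" and \<Delta>: "Delta2_at_0 \<Phi>"
begin

lemma orlicz_space_scale:
  assumes "f \<in> orlicz_space \<Phi> X"
  shows "(\<lambda>x. c * f x) \<in> orlicz_space \<Phi> X"
  using assms unfolding orlicz_space_iff_summable[OF \<Phi> \<Delta>] by (simp flip: mult.assoc)

lemma orlicz_space_zero: "0 \<in> orlicz_space \<Phi> X"
  unfolding orlicz_space_iff_summable[OF \<Phi> \<Delta>] by (simp add: N_function_zero[OF \<Phi>])

lemma orlicz_space_uminus: "f \<in> orlicz_space \<Phi> X \<Longrightarrow> - f \<in> orlicz_space \<Phi> X"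
  using orlicz_space_scale[of f "-1"] by (simp add: fun_Compl_def)

lemma orlicz_space_add:
  assumes "f \<in> orlicz_space \<Phi> X" "g \<in> orlicz_space \<Phi> X"
  shows "f + g \<in> orlicz_space \<Phi> X"
proof -
  have f: "(\<lambda>x. \<Phi> (c * f x)) summable_on X" and g: "(\<lambda>x. \<Phi> (c * g x)) summable_on X" for c
    using assms unfolding orlicz_space_iff_summable[OF \<Phi> \<Delta>] by auto
  have "(\<lambda>x. \<Phi> (c * (f + g) x)) summable_on X" for c
  proof (rule summable_on_comparison_test)
    show "(\<lambda>x. (1/2) * \<Phi> ((2 * c) * f x) + (1/2) * \<Phi> ((2 * c) * g x)) summable_on X"
      by (intro summable_on_add summable_on_cmult_right f g)
    show "\<Phi> (c * (f + g) x) \<le> (1/2) * \<Phi> ((2 * c) * f x) + (1/2) * \<Phi> ((2 * c) * g x)" for x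
      using N_function_half_add[OF \<Phi>, of "c * f x" "c * g x"]
      by (simp add: algebra_simps)
  qed (rule N_function_nonneg[OF \<Phi>])
  then show ?thesis
    using assms unfolding orlicz_space_iff_summable[OF \<Phi> \<Delta>] by auto
qed

lemma orlicz_space_diff:
  "f \<in> orlicz_space \<Phi> X \<Longrightarrow> g \<in> orlicz_space \<Phi> X \<Longrightarrow> f - g \<in> orlicz_space \<Phi> X"
  using orlicz_space_add[of f "- g"] orlicz_space_uminus[of g] by simp

lemma orlicz_space_sum:
  "(\<And>i. i \<in> I \<Longrightarrow> f i \<in> orlicz_space \<Phi> X) \<Longrightarrow> (\<Sum>i\<in>I. f i) \<in> orlicz_space \<Phi> X"
  by (induction I rule: infinite_finite_induct) (auto intro: orlicz_space_zero orlicz_space_add)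

text \<open>
  The scale \<open>\<epsilon>/2\<close> is admissible in the infimum, which leaves room for strict inequality.
\<close>

lemma gauge_norm_less:
  assumes "0 < \<epsilon>" "(\<lambda>x. \<Phi> ((2 / \<epsilon>) * f x)) summable_on X"
    "(\<Sum>\<^sub>\<infinity>x\<in>X. \<Phi> ((2 / \<epsilon>) * f x)) \<le> 1"
  shows "gauge_norm \<Phi> X f < \<epsilon>"
proof -
  have eq: "f x / (\<epsilon> / 2) = (2 / \<epsilon>) * f x" for x by simp
  have "modular \<Phi> X (\<lambda>x. f x / (\<epsilon> / 2)) \<le> 1"
    unfolding eq modular_eq_ennreal_infsum[OF \<Phi> assms(2)] using assms(3) ennreal_leI by fastforce
  then have "gauge_norm \<Phi> X f \<le> \<epsilon> / 2"
    unfolding gauge_norm_def using assms(1)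
    by (intro cInf_lower bdd_belowI[of _ 0]) auto
  then show ?thesis using assms(1) by simp
qed

end


section \<open>The left regular representation\<close>

lemma (in group) bij_betw_left_translation:
  assumes "g \<in> carrier G"
  shows "bij_betw (\<lambda>x. g \<otimes> x) (carrier G) (carrier G)"
  using assms surj_const_mult inj_on_cmult by (simp add: bij_betw_def)

lemma left_regular_add:
  "left_regular G g (f + h) = left_regular G g f + left_regular G g h"
  by (auto simp: left_regular_def fun_eq_iff)

lemma left_regular_uminus: "left_regular G g (- f) = - left_regular G g f"
  by (auto simp: left_regular_def fun_eq_iff)

lemma left_regular_diff:
  "left_regular G g (f - h) = left_regular G g f - left_regular G g h"
  by (auto simp: left_regular_def fun_eq_iff)

lemma left_regular_zero: "left_regular G g 0 = 0"
  by (auto simp: left_regular_def fun_eq_iff)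

lemma (in group) left_regular_mult:
  assumes "g \<in> carrier G" "h \<in> carrier G"
  shows "left_regular G (g \<otimes> h) f = left_regular G g (left_regular G h f)"
  using assms by (auto simp: left_regular_def fun_eq_iff inv_mult_group m_assoc)

lemma (in group) left_regular_orlicz_space:
  assumes \<Phi>: "N_function \<Phi>" and \<Delta>: "Delta2_at_0 \<Phi>"
    and g: "g \<in> carrier G" and f: "f \<in> orlicz_space \<Phi> (carrier G)"
  shows "left_regular G g f \<in> orlicz_space \<Phi> (carrier G)"
proof -
  have "(\<lambda>x. \<Phi> (c * left_regular G g f x)) summable_on carrier G" for c
  proof -
    have "(\<lambda>x. \<Phi> (c * f (inv g \<otimes> x))) summable_on carrier G"
      using f summable_on_reindex_bij_betw[OF bij_betw_left_translation[OF inv_closed[OF g]],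
          of "\<lambda>x. \<Phi> (c * f x)"]
      unfolding orlicz_space_iff_summable[OF \<Phi> \<Delta>] by blast
    then show ?thesis
      by (rule summable_on_cong[THEN iffD1, rotated]) (simp add: left_regular_def)
  qed
  then show ?thesis
    unfolding orlicz_space_iff_summable[OF \<Phi> \<Delta>] by (simp add: left_regular_def)
qed

section \<open>Averages over distinct translates\<close>

definition translate_average ::
    "('g, 'm) monoid_scheme \<Rightarrow> (nat \<Rightarrow> 'g) \<Rightarrow> nat \<Rightarrow> ('g \<Rightarrow> real) \<Rightarrow> 'g \<Rightarrow> real" where
  "translate_average G z n f = (\<lambda>x. (\<Sum>i<n. left_regular G (z i) f x) / real n)"

lemma has_sum_sum_finite:
  fixes f :: "'i \<Rightarrow> 'x \<Rightarrow> real"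
  assumes "finite I" "\<And>i. i \<in> I \<Longrightarrow> (f i has_sum s i) X"
  shows "((\<lambda>x. \<Sum>i\<in>I. f i x) has_sum (\<Sum>i\<in>I. s i)) X"
  using assms by (induction I rule: finite_induct) (auto intro: has_sum_add)

text \<open>
  Distinctness of the \<open>z i\<close> is what makes the average spread out: at a point \<open>x\<close> the values
  \<open>f(z\<^sub>i\<^sup>-\<^sup>1 x)\<close> are taken at different points, so for \<open>f\<close> supported on a finite set \<open>A\<close>
  their sum is bounded by the \<open>\<ell>\<^sup>1\<close>-norm of \<open>f\<close> on \<open>A\<close>, independently of \<open>n\<close>.
\<close>

lemma (in group) translate_average_eventually_small:
  assumes \<Phi>: "N_function \<Phi>" and \<Delta>: "Delta2_at_0 \<Phi>"
    and z: "inj z" "range z \<subseteq> carrier G"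
    and f: "f \<in> orlicz_space \<Phi> (carrier G)" and "0 < \<epsilon>"
  shows "\<forall>\<^sub>F n in sequentially. gauge_norm \<Phi> (carrier G) (translate_average G z n f) < \<epsilon>"
proof -
  define c where "c = 2 / \<epsilon>"
  have "c > 0" using \<open>0 < \<epsilon>\<close> by (simp add: c_def)
  have zc: "z i \<in> carrier G" for i using z by auto
  have summ: "(\<lambda>x. \<Phi> (2 * c * f x)) summable_on carrier G"
    using f unfolding orlicz_space_iff_summable[OF \<Phi> \<Delta>] by blast
  \<comment> \<open>The factor \<open>2\<close> in \<open>2 * c\<close> pays for splitting \<open>f\<close> into two summands by convexity.\<close>
  obtain A where A: "finite A" "A \<subseteq> carrier G"
    and dist: "dist (\<Sum>x\<in>A. \<Phi> (2 * c * f x)) (\<Sum>\<^sub>\<infinity>x\<in>carrier G. \<Phi> (2 * c * f x)) \<le> 1"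
    using infsum_finite_approximation[OF summ zero_less_one] by auto
  define f1 where "f1 x = (if x \<in> A then f x else 0)" for x
  define f2 where "f2 x = (if x \<in> A then 0 else f x)" for x
  define q where "q = (\<Sum>\<^sub>\<infinity>x\<in>carrier G. \<Phi> (2 * c * f2 x))"
  define M where "M = 2 * c * (\<Sum>a\<in>A. \<bar>f a\<bar>)"
  have "M \<ge> 0" using \<open>c > 0\<close> by (simp add: M_def sum_nonneg)

  have summ2: "(\<lambda>x. \<Phi> (2 * c * f2 x)) summable_on carrier G"
    by (rule N_function_summable_mono[OF \<Phi> summ]) (simp add: f2_def)
  have "q = (\<Sum>\<^sub>\<infinity>x\<in>carrier G - A. \<Phi> (2 * c * f x))"
    unfolding q_def
    by (rule infsum_cong_neutral) (auto simp: f2_def N_function_zero[OF \<Phi>])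
  also have "\<dots> = (\<Sum>\<^sub>\<infinity>x\<in>carrier G. \<Phi> (2 * c * f x)) - (\<Sum>x\<in>A. \<Phi> (2 * c * f x))"
    using A by (subst infsum_Diff[OF summ]) auto
  finally have q: "q \<le> 1"
    using dist by (simp add: dist_real_def)

  have "(\<lambda>n. real (card A) * (real n * \<Phi> (M / real n))) \<longlonglongrightarrow> real (card A) * 0"
    by (intro tendsto_mult tendsto_const N_function_sublinear_at_0[OF \<Phi>])
  then have "\<forall>\<^sub>F n in sequentially. real (card A) * (real n * \<Phi> (M / real n)) < 1"
    by (rule order_tendstoD) simp
  with eventually_gt_at_top[of 0] show ?thesis
  proof eventually_elim
    case (elim n)
    then have n: "n > 0" "real (card A) * (real n * \<Phi> (M / real n)) < 1" by auto
    \<comment> \<open>The modular of the average is dominated by the sum of \<open>P / 2\<close> (from \<open>f1\<close>, living on \<open>S\<close>)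
      and \<open>Q / 2\<close> (from \<open>f2\<close>, by Jensen's inequality).\<close>
    define y where "y i x = inv (z i) \<otimes> x" for i x
    define S where "S = (\<lambda>(i, a). z i \<otimes> a) ` ({..<n} \<times> A)"
    define P where "P x = (if x \<in> S then \<Phi> (M / real n) else 0)" for x
    define Q where "Q x = (1 / real n) * (\<Sum>i<n. \<Phi> (2 * c * f2 (y i x)))" for x
    have S: "finite S" "S \<subseteq> carrier G"
      using A zc by (auto simp: S_def)
    have cardS: "card S \<le> n * card A"
      unfolding S_def using card_image_le[of "{..<n} \<times> A"] A by (simp add: card_cartesian_product)

    have "((\<lambda>x. \<Phi> (M / real n)) has_sum (real (card S) * \<Phi> (M / real n))) S"
      using S by simp
    then have "(P has_sum (real (card S) * \<Phi> (M / real n))) (carrier G)"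
      by (rule has_sum_cong_neutral[THEN iffD1, rotated -1]) (use S in \<open>auto simp: P_def\<close>)
    moreover have "(Q has_sum ((1 / real n) * (\<Sum>i<n. q))) (carrier G)"
      unfolding Q_def
    proof (intro has_sum_cmult_right has_sum_sum_finite)
      fix i
      have "((\<lambda>x. \<Phi> (2 * c * f2 x)) has_sum q) (carrier G)"
        unfolding q_def using summ2 by simp
      then show "((\<lambda>x. \<Phi> (2 * c * f2 (y i x))) has_sum q) (carrier G)"
        unfolding y_def
        using has_sum_reindex_bij_betw[OF bij_betw_left_translation[OF inv_closed[OF zc[of i]]],
          of "\<lambda>x. \<Phi> (2 * c * f2 x)" q] by simp
    qed simp
    ultimately have dom: "((\<lambda>x. (1/2) * P x + (1/2) * Q x) has_sum
        ((1/2) * (real (card S) * \<Phi> (M / real n)) + (1/2) * ((1 / real n) * (\<Sum>i<n. q)))) (carrier G)"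
      by (intro has_sum_add has_sum_cmult_right)

    have le: "\<Phi> (c * translate_average G z n f x) \<le> (1/2) * P x + (1/2) * Q x"
      if x: "x \<in> carrier G" for x
    proof -
      define I where "I = {i \<in> {..<n}. y i x \<in> A}"
      have inj: "inj_on (\<lambda>i. y i x) I"
      proof (rule inj_onI)
        fix i j assume "y i x = y j x"
        then have "z i = z j"
          using x zc unfolding y_def by (metis inv_closed inv_inv right_cancel)
        then show "i = j" using z(1) by (simp add: inj_eq)
      qed
      have "(\<Sum>i<n. \<bar>f1 (y i x)\<bar>) = (\<Sum>i\<in>I. \<bar>f (y i x)\<bar>)"
        unfolding I_def by (subst sum.inter_filter) (auto simp: f1_def intro: sum.cong)
      also have "\<dots> = (\<Sum>a\<in>(\<lambda>i. y i x) ` I. \<bar>f a\<bar>)"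
        by (simp add: sum.reindex[OF inj])
      also have "\<dots> \<le> (\<Sum>a\<in>A. \<bar>f a\<bar>)"
        using A by (intro sum_mono2) (auto simp: I_def)
      finally have bound: "\<bar>\<Sum>i<n. f1 (y i x)\<bar> \<le> (\<Sum>a\<in>A. \<bar>f a\<bar>)"
        using sum_abs[of "\<lambda>i. f1 (y i x)" "{..<n}"] by linarith
      have P: "\<Phi> (2 * (c * (\<Sum>i<n. f1 (y i x)) / real n)) \<le> P x"
      proof (cases "x \<in> S")
        case True
        have "\<bar>2 * (c * (\<Sum>i<n. f1 (y i x)) / real n)\<bar> = 2 * c * \<bar>\<Sum>i<n. f1 (y i x)\<bar> / real n"
          using \<open>c > 0\<close> by (simp add: abs_mult)
        also have "\<dots> \<le> \<bar>M / real n\<bar>"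
          using \<open>c > 0\<close> \<open>M \<ge> 0\<close> bound unfolding M_def by (simp add: divide_right_mono)
        finally show ?thesis
          using True N_function_mono[OF \<Phi>] by (simp add: P_def)
      next
        case False
        have "y i x \<notin> A" if "i < n" for i
        proof
          assume "y i x \<in> A"
          moreover have "z i \<otimes> y i x = x"
            using x zc by (simp add: y_def flip: m_assoc)
          ultimately have "x \<in> S"
            using that unfolding S_def by (metis (no_types, lifting) SigmaI image_eqI lessThan_iff old.prod.case)
          then show False using False by simp
        qed
        then have "(\<Sum>i<n. f1 (y i x)) = 0" by (intro sum.neutral) (simp add: f1_def)
        then show ?thesis by (simp add: P_def False N_function_zero[OF \<Phi>])
      qed
      have eq: "2 * (c * (\<Sum>i<n. f2 (y i x)) / real n) = (\<Sum>i<n. 2 * c * f2 (y i x)) / real n"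
        by (simp add: sum_distrib_left mult.assoc)
      have Q: "\<Phi> (2 * (c * (\<Sum>i<n. f2 (y i x)) / real n)) \<le> Q x"
        unfolding eq Q_def
        using N_function_average[OF \<Phi> n(1), of "\<lambda>i. 2 * c * f2 (y i x)"] by simp
      have "c * translate_average G z n f x
          = c * (\<Sum>i<n. f1 (y i x)) / real n + c * (\<Sum>i<n. f2 (y i x)) / real n"
      proof -
        have "(\<Sum>i<n. left_regular G (z i) f x) = (\<Sum>i<n. f1 (y i x) + f2 (y i x))"
          using x by (intro sum.cong) (auto simp: left_regular_def f1_def f2_def y_def)
        then show ?thesis
          by (simp add: translate_average_def sum.distrib add_divide_distrib distrib_left)
      qed
      then show ?thesis
        using N_function_half_add[OF \<Phi>, of "c * (\<Sum>i<n. f1 (y i x)) / real n"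
            "c * (\<Sum>i<n. f2 (y i x)) / real n"] P Q by simp
    qed

    have summ3: "(\<lambda>x. \<Phi> (c * translate_average G z n f x)) summable_on carrier G"
      by (rule summable_on_comparison_test[OF has_sum_imp_summable[OF dom] le N_function_nonneg[OF \<Phi>]])
    have "(\<Sum>\<^sub>\<infinity>x\<in>carrier G. \<Phi> (c * translate_average G z n f x))
        \<le> (1/2) * (real (card S) * \<Phi> (M / real n)) + (1/2) * ((1 / real n) * (\<Sum>i<n. q))"
      by (rule has_sum_mono[OF has_sum_infsum[OF summ3] dom le])
    also have "\<dots> = (1/2) * (real (card S) * \<Phi> (M / real n)) + (1/2) * q"
      using n by simp
    finally have "(\<Sum>\<^sub>\<infinity>x\<in>carrier G. \<Phi> (c * translate_average G z n f x))
        \<le> (1/2) * (real (card S) * \<Phi> (M / real n)) + (1/2) * q" .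
    moreover have "real (card S) * \<Phi> (M / real n) \<le> real (n * card A) * \<Phi> (M / real n)"
      using cardS by (intro mult_right_mono N_function_nonneg[OF \<Phi>] of_nat_mono)
    moreover have "real (n * card A) * \<Phi> (M / real n) < 1"
      using n(2) by (simp add: mult_ac)
    ultimately have "(\<Sum>\<^sub>\<infinity>x\<in>carrier G. \<Phi> (c * translate_average G z n f x)) \<le> 1"
      using q by linarith
    then show ?case
      using gauge_norm_less[OF \<Phi> \<Delta> \<open>0 < \<epsilon>\<close>] summ3 unfolding c_def by blast
  qed
qed

section \<open>Cocycles\<close>

lemma (in group) left_regular_coboundary:
  assumes \<Phi>: "N_function \<Phi>" and \<Delta>: "Delta2_at_0 \<Phi>" and v: "v \<in> orlicz_space \<Phi> (carrier G)"
  shows "(\<lambda>g. if g \<in> carrier G then left_regular G g v - v else 0)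
    \<in> coboundaries G (orlicz_space \<Phi> (carrier G)) (left_regular G)"
proof -
  let ?V = "orlicz_space \<Phi> (carrier G)"
  have "left_regular G g v - v \<in> ?V" if "g \<in> carrier G" for g
    using v that by (intro orlicz_space_diff[OF \<Phi> \<Delta>] left_regular_orlicz_space[OF \<Phi> \<Delta>])
  then show ?thesis
    using v unfolding coboundaries_def cocycles_def
    by (auto simp: left_regular_mult left_regular_diff)
qed

text \<open>
  Compute \<open>b\<close> on \<open>zg = gz\<close> in both orders.
\<close>

lemma (in group) cocycle_central:
  assumes b: "b \<in> cocycles G V \<pi>" and "z \<in> center G" and "g \<in> carrier G"
  shows "\<pi> g (b z) - b z = \<pi> z (b g) - b g"
proof -
  have z: "z \<in> carrier G" "z \<otimes> g = g \<otimes> z"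
    using assms by (auto simp: center_def)
  have "b z + \<pi> z (b g) = b (z \<otimes> g)" "b g + \<pi> g (b z) = b (g \<otimes> z)"
    using b \<open>g \<in> carrier G\<close> z(1) by (simp_all add: cocycles_def)
  then have "b z + \<pi> z (b g) = b g + \<pi> g (b z)"
    by (simp add: z(2))
  then show ?thesis by (simp add: algebra_simps)
qed

text \<open>
  The approximating coboundary comes from minus the average of \<open>b\<close> over distinct central
  elements. By \<open>cocycle_central\<close> its error at \<open>g\<close> is the average of the corresponding
  translates of \<open>- b(g)\<close>, and one \<open>n\<close> serves for all \<open>g\<close> in the finite set \<open>F\<close>.
\<close>

lemma (in group) cocycle_approximation:
  assumes \<Phi>: "N_function \<Phi>" and \<Delta>: "Delta2_at_0 \<Phi>" and inf: "infinite (center G)"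
    and b: "b \<in> cocycles G (orlicz_space \<Phi> (carrier G)) (left_regular G)"
    and F: "finite F" "F \<subseteq> carrier G" and "0 < \<epsilon>"
  obtains a where "a \<in> coboundaries G (orlicz_space \<Phi> (carrier G)) (left_regular G)"
    "\<And>g. g \<in> F \<Longrightarrow> gauge_norm \<Phi> (carrier G) (a g - b g) < \<epsilon>"
proof -
  let ?V = "orlicz_space \<Phi> (carrier G)"
  obtain z :: "nat \<Rightarrow> 'a" where z: "inj z" "range z \<subseteq> center G"
    using inf infinite_countable_subset by blast
  have zc: "range z \<subseteq> carrier G" using z by (auto simp: center_def)
  have bV: "b g \<in> ?V" if "g \<in> carrier G" for g
    using b that by (simp add: cocycles_def)
  have "\<forall>\<^sub>F n in sequentially. \<forall>g\<in>F.
      gauge_norm \<Phi> (carrier G) (translate_average G z n (- b g)) < \<epsilon>"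
    using F by (intro eventually_ball_finite ballI translate_average_eventually_small[OF \<Phi> \<Delta> z(1) zc]
        orlicz_space_uminus[OF \<Phi> \<Delta>] bV \<open>0 < \<epsilon>\<close>) auto
  with eventually_gt_at_top[of 0] have "\<forall>\<^sub>F n in sequentially. 0 < n \<and> (\<forall>g\<in>F.
      gauge_norm \<Phi> (carrier G) (translate_average G z n (- b g)) < \<epsilon>)"
    by eventually_elim simp
  then obtain n where n: "0 < n"
    "\<And>g. g \<in> F \<Longrightarrow> gauge_norm \<Phi> (carrier G) (translate_average G z n (- b g)) < \<epsilon>"
    by (metis (mono_tags, lifting) eventually_happens sequentially_bot)
  define v where "v = (\<lambda>x. (- 1 / real n) * (\<Sum>i<n. b (z i)) x)"
  define a where "a = (\<lambda>g. if g \<in> carrier G then left_regular G g v - v else 0)"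
  have "v \<in> ?V"
    unfolding v_def using zc
    by (intro orlicz_space_scale[OF \<Phi> \<Delta>] orlicz_space_sum[OF \<Phi> \<Delta>] bV) auto
  then have "a \<in> coboundaries G ?V (left_regular G)"
    unfolding a_def by (rule left_regular_coboundary[OF \<Phi> \<Delta>])
  moreover have "a g - b g = translate_average G z n (- b g)" if g: "g \<in> carrier G" for g
  proof
    fix x
    have apply_sum: "(\<Sum>i<n. h i) x = (\<Sum>i<n. h i x)" for h :: "nat \<Rightarrow> 'a \<Rightarrow> real" and x
      by (induction n) auto
    have gv: "left_regular G g v x = (- 1 / real n) * (\<Sum>i<n. left_regular G g (b (z i)) x)"
      by (simp add: left_regular_def v_def apply_sum)
    have vx: "v x = (- 1 / real n) * (\<Sum>i<n. b (z i) x)"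
      by (simp add: v_def apply_sum)
    have "a g x = (- 1 / real n) * (\<Sum>i<n. left_regular G g (b (z i)) x - b (z i) x)"
      using g by (simp add: a_def gv vx sum_subtractf right_diff_distrib diff_divide_distrib)
    also have "(\<Sum>i<n. left_regular G g (b (z i)) x - b (z i) x)
        = (\<Sum>i<n. left_regular G (z i) (b g) x - b g x)"
    proof (rule sum.cong)
      fix i
      have "left_regular G g (b (z i)) - b (z i) = left_regular G (z i) (b g) - b g"
        using z g by (intro cocycle_central[OF b]) auto
      then show "left_regular G g (b (z i)) x - b (z i) x = left_regular G (z i) (b g) x - b g x"
        by (metis minus_apply)
    qed simp
    finally show "(a g - b g) x = translate_average G z n (- b g) x"
      using n(1) by (simp add: translate_average_def left_regular_uminus sum_subtractf sum_negf
          field_simps)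
  qed
  ultimately show ?thesis
    using n(2) F(2) by (intro that[of a]) auto
qed

lemma (in group) reduced_coboundaries_eq_cocycles:
  assumes \<Phi>: "N_function \<Phi>" and \<Delta>: "Delta2_at_0 \<Phi>" and inf: "infinite (center G)"
  shows "reduced_coboundaries G (orlicz_space \<Phi> (carrier G)) (gauge_norm \<Phi> (carrier G))
      (left_regular G) = cocycles G (orlicz_space \<Phi> (carrier G)) (left_regular G)"
    (is "reduced_coboundaries G ?V ?N ?L = _")
proof
  show "reduced_coboundaries G ?V ?N ?L \<subseteq> cocycles G ?V ?L"
    unfolding reduced_coboundaries_def
    using closure_of_subset_topspace[of "cocycle_topology G ?V ?N ?L"]
    unfolding topspace_cocycle_topology .
  show "cocycles G ?V ?L \<subseteq> reduced_coboundaries G ?V ?N ?L"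
  proof
    fix b assume b: "b \<in> cocycles G ?V ?L"
    have "\<exists>a. a \<in> coboundaries G ?V ?L \<and> a \<in> U"
      if U: "b \<in> U" "cocycle_open G ?V ?N ?L U" for U
    proof -
      obtain F \<epsilon> where F: "finite F" "F \<subseteq> carrier G" "\<epsilon> > 0"
        and sub: "{c \<in> cocycles G ?V ?L. \<forall>g\<in>F. ?N (c g - b g) < \<epsilon>} \<subseteq> U"
        using U unfolding cocycle_open_def by blast
      obtain a where a: "a \<in> coboundaries G ?V ?L" "\<And>g. g \<in> F \<Longrightarrow> ?N (a g - b g) < \<epsilon>"
        using cocycle_approximation[OF \<Phi> \<Delta> inf b F] by blast
      then have "a \<in> U" using sub by (auto simp: coboundaries_def)
      then show ?thesis using a(1) by blast
    qed
    then show "b \<in> reduced_coboundaries G ?V ?N ?L"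
      unfolding reduced_coboundaries_def in_closure_of topspace_cocycle_topology
        openin_cocycle_topology using b by blast
  qed
qed

lemma (in group) group_cocycle_group:
  assumes \<Phi>: "N_function \<Phi>" and \<Delta>: "Delta2_at_0 \<Phi>"
  shows "group (cocycle_group G (orlicz_space \<Phi> (carrier G)) (left_regular G))"
proof (rule groupI)
  let ?V = "orlicz_space \<Phi> (carrier G)" and ?L = "left_regular G"
  have simps: "carrier (cocycle_group G ?V ?L) = cocycles G ?V ?L"
    "monoid.mult (cocycle_group G ?V ?L) = (\<lambda>b c. b + c)"
    "one (cocycle_group G ?V ?L) = 0"
    by (auto simp: cocycle_group_def)
  fix b c d
  assume b: "b \<in> carrier (cocycle_group G ?V ?L)"
  have "- b \<in> cocycles G ?V ?L"
    using b unfolding simps cocycles_def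
    by (auto simp: left_regular_uminus intro: orlicz_space_uminus[OF \<Phi> \<Delta>])
  then show "\<exists>a\<in>carrier (cocycle_group G ?V ?L). a \<otimes>\<^bsub>cocycle_group G ?V ?L\<^esub> b
      = \<one>\<^bsub>cocycle_group G ?V ?L\<^esub>"
    unfolding simps by (intro bexI[of _ "- b"]) auto
  assume c: "c \<in> carrier (cocycle_group G ?V ?L)"
  show "b \<otimes>\<^bsub>cocycle_group G ?V ?L\<^esub> c \<in> carrier (cocycle_group G ?V ?L)"
    using b c unfolding simps cocycles_def
    by (auto simp: left_regular_add algebra_simps intro: orlicz_space_add[OF \<Phi> \<Delta>])
qed (auto simp: cocycle_group_def cocycles_def left_regular_zero add.assoc
      intro: orlicz_space_zero[OF \<Phi> \<Delta>])

lemma (in group) trivial_group_self_factor: "trivial_group (G Mod carrier G)"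
proof -
  interpret Q: group "G Mod carrier G"
    by (rule normal.factorgroup_is_group[OF normal_self])
  have "carrier (G Mod carrier G) \<subseteq> {carrier G}"
    by (auto simp: FactGroup_def RCOSETS_def coset_join2 subgroup_self)
  then show ?thesis by (auto simp: Q.trivial_group_alt)
qed

theorem corollary4p2:
  fixes \<Phi> :: "real \<Rightarrow> real" and G :: "('g, 'm) monoid_scheme"
  assumes "N_function \<Phi>" and "Delta2_at_0 \<Phi>" and "Nabla2_at_0 \<Phi>"
    and "group G" and "finitely_generated G" and "infinite (center G)"
  shows "trivial_group
    (reduced_H1 G (orlicz_space \<Phi> (carrier G)) (gauge_norm \<Phi> (carrier G)) (left_regular G))"
proof -
  let ?Z = "cocycle_group G (orlicz_space \<Phi> (carrier G)) (left_regular G)"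
  have "group ?Z"
    by (rule group.group_cocycle_group[OF assms(4,1,2)])
  then have "trivial_group (?Z Mod carrier ?Z)"
    by (rule group.trivial_group_self_factor)
  then show ?thesis
    unfolding reduced_H1_def group.reduced_coboundaries_eq_cocycles[OF assms(4,1,2,6)]
    by (simp add: cocycle_group_def)
qed

end
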